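(* Let $X$ and $Y$ be topological spaces and let $\mathcal{G}$ be a closed cover of $Y$ that is regular for $X \times [0,1]$. Then every two $\mathcal{G}$-close maps $f, g \colon X \to Y$ are $\mathcal{G}$-homotopic. Moreover, there exists a $\mathcal{G}$-homotopy $H \colon X \times [0,1] \to Y$ from $f$ to $g$ with the additional property that for each $x \in X$ and each $G \in \mathcal{G}$, if both endpoints $f(x)$ and $g(x)$ of the path $t \mapsto H(x,t)$ lie in $G$, then the entire path $H(\{x\} \times [0,1])$ lies in $G$.
   Context: Maps are continuous. A space $Z$ is an absolute extensor for a space $W$ if each map from a closed subset of $W$ into $Z$ extends over all of $W$; $AE(W)$ is the class of absolute extensors for $W$. Convention: the empty set is counted as a member of $AE(W)$ (i.e. only non-empty closed subsets are considered in the definition; for non-empty $Z$ this makes no difference). An $AE(W)$-cover is a cover such that the intersection of each non-empty collection of its elements belongs to $AE(W)$. A cover is locally finite dimensional if its nerve is, i.e. for each element $G$ of the cover there is a finite bound on the cardinality of finite subcollections containing $G$ that have non-empty intersection. A closed cover (all elements closed) is regular for a space $W$ if it is a locally finite, locally finite dimensional $AE(W)$-cover. Two maps $f, g \colon X \to Y$ are $\mathcal{G}$-close if for each $x \in X$ there is $G \in \mathcal{G}$ with $f(x), g(x) \in G$. They are $\mathcal{G}$-homotopic if there is a homotopy $H \colon X \times [0,1] \to Y$ from $f$ to $g$ (a $\mathcal{G}$-homotopy) such that for each $x \in X$ there is $G \in \mathcal{G}$ with $H(\{x\} \times [0,1]) \subset G$. *)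

theory Defs
  imports "HOL-Analysis.Analysis"
begin

text \<open>
  Spaces are abstract topologies, so that the empty space and arbitrary carriers are covered.
\<close>

text \<open>
  \<open>absolute_extensor W Z\<close> renders \<open>Z \<in> AE(W)\<close>. Only non-empty closed sets \<open>A\<close> are considered, so
  that the empty space is an absolute extensor for every \<open>W\<close>.
\<close>

definition absolute_extensor :: "'w topology \<Rightarrow> 'z topology \<Rightarrow> bool" where
  "absolute_extensor W Z \<longleftrightarrow>
     (\<forall>A u. closedin W A \<and> A \<noteq> {} \<and> continuous_map (subtopology W A) Z u \<longrightarrow>
        (\<exists>v. continuous_map W Z v \<and> (\<forall>a\<in>A. v a = u a)))"

definition cover_of :: "'b topology \<Rightarrow> 'b set set \<Rightarrow> bool" where
  "cover_of Y \<G> \<longleftrightarrow> \<Union>\<G> = topspace Y"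

definition closed_cover_of :: "'b topology \<Rightarrow> 'b set set \<Rightarrow> bool" where
  "closed_cover_of Y \<G> \<longleftrightarrow> cover_of Y \<G> \<and> (\<forall>G\<in>\<G>. closedin Y G)"

text \<open>The subcollections \<open>\<F>\<close> below may be infinite.\<close>

definition AE_cover_of :: "'w topology \<Rightarrow> 'b topology \<Rightarrow> 'b set set \<Rightarrow> bool" where
  "AE_cover_of W Y \<G> \<longleftrightarrow>
     cover_of Y \<G> \<and>
     (\<forall>\<F>. \<F> \<subseteq> \<G> \<and> \<F> \<noteq> {} \<longrightarrow> absolute_extensor W (subtopology Y (\<Inter>\<F>)))"

text \<open>The bound \<open>n\<close> may depend on \<open>G\<close>.\<close>

definition locally_finite_dimensional :: "'b set set \<Rightarrow> bool" where
  "locally_finite_dimensional \<G> \<longleftrightarrow>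
     (\<forall>G\<in>\<G>. \<exists>n::nat. \<forall>\<F>. \<F> \<subseteq> \<G> \<and> finite \<F> \<and> G \<in> \<F> \<and> \<Inter>\<F> \<noteq> {} \<longrightarrow> card \<F> \<le> n)"

definition regular_closed_cover :: "'w topology \<Rightarrow> 'b topology \<Rightarrow> 'b set set \<Rightarrow> bool" where
  "regular_closed_cover W Y \<G> \<longleftrightarrow>
     closed_cover_of Y \<G> \<and> locally_finite_in Y \<G> \<and>
     locally_finite_dimensional \<G> \<and> AE_cover_of W Y \<G>"

definition cover_close :: "'a topology \<Rightarrow> 'b set set \<Rightarrow> ('a \<Rightarrow> 'b) \<Rightarrow> ('a \<Rightarrow> 'b) \<Rightarrow> bool" where
  "cover_close X \<G> f g \<longleftrightarrow> (\<forall>x\<in>topspace X. \<exists>G\<in>\<G>. f x \<in> G \<and> g x \<in> G)"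

abbreviation cylinder :: "'a topology \<Rightarrow> ('a \<times> real) topology" where
  "cylinder X \<equiv> prod_topology X (top_of_set {0..1})"

text \<open>
  The library relation \<open>homotopic_with\<close> takes the time parameter as first component and does not
  expose the homotopy itself, whose tracks matter here.
\<close>

definition cover_homotopy ::
  "'a topology \<Rightarrow> 'b topology \<Rightarrow> 'b set set \<Rightarrow> ('a \<Rightarrow> 'b) \<Rightarrow> ('a \<Rightarrow> 'b) \<Rightarrow> ('a \<times> real \<Rightarrow> 'b) \<Rightarrow> bool" where
  "cover_homotopy X Y \<G> f g H \<longleftrightarrow>
     continuous_map (cylinder X) Y H \<and>
     (\<forall>x\<in>topspace X. H (x, 0) = f x \<and> H (x, 1) = g x) \<and>
     (\<forall>x\<in>topspace X. \<exists>G\<in>\<G>. H ` ({x} \<times> {0..1}) \<subseteq> G)"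

definition cover_homotopic ::
  "'a topology \<Rightarrow> 'b topology \<Rightarrow> 'b set set \<Rightarrow> ('a \<Rightarrow> 'b) \<Rightarrow> ('a \<Rightarrow> 'b) \<Rightarrow> bool" where
  "cover_homotopic X Y \<G> f g \<longleftrightarrow> (\<exists>H. cover_homotopy X Y \<G> f g H)"

end

theory Submission
  imports Defs
begin

text \<open>
  Put \<open>F G = {x. f x \<in> G \<and> g x \<in> G} \<times> {0..1}\<close> for \<open>G \<in> \<G>\<close>. Because \<open>f\<close> and \<open>g\<close> are \<open>\<G>\<close>-close,
  these sets cover the cylinder; they are closed and locally finite because \<open>\<G>\<close> is. A homotopy with the sharp track
  property is the same thing as an extension to the whole cylinder of the map given by \<open>f\<close> at the
  bottom and \<open>g\<close> at the top that sends each \<open>F G\<close> into \<open>G\<close>. So the theorem is an instance of an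
  extension problem with prescribed carriers: given sets \<open>F i\<close> covering \<open>W\<close>, targets \<open>C i\<close>, and a
  map \<open>u\<close> on a closed set \<open>B\<close> with \<open>u (B \<inter> F i) \<subseteq> C i\<close>, extend \<open>u\<close> so that \<open>F i\<close> goes into \<open>C i\<close>
  (\<open>carrier_respecting_extension\<close>).

  The extension is built over the intersections \<open>N S = (\<Inter>i\<in>S. F i)\<close>, the deepest ones first.
  When a map is already given on \<open>N (insert j S)\<close> for each \<open>j \<notin> S\<close>, these maps agree on overlaps,
  because two of them meet in \<open>N (insert i (insert j S))\<close>, where both were made to extend the same
  earlier map; likewise they agree with \<open>u\<close>. Local finiteness allows pasting them to one map on a
  closed set. It takes values in \<open>D S = (\<Inter>i\<in>S. C i)\<close>, and since \<open>D S\<close> is an absolute extensor it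
  extends to the map belonging to \<open>S\<close>. Local finite dimensionality is what allows this recursion
  to start: a simplex of the nerve cannot be enlarged infinitely often, so reverse inclusion is
  well-founded on the nerve (\<open>wf_enlarge_simplex\<close>), even if its dimension is infinite.
  Finally the maps belonging to the vertices agree on overlaps and paste to the desired extension.
\<close>

section \<open>The nerve of a locally finite dimensional family\<close>

definition nerve :: "'i set \<Rightarrow> ('i \<Rightarrow> 'w set) \<Rightarrow> 'i set set" where
  "nerve I F = {S. S \<subseteq> I \<and> finite S \<and> S \<noteq> {} \<and> (\<Inter>i\<in>S. F i) \<noteq> {}}"

text \<open>
  The simplices with a common vertex \<open>i\<close> have bounded cardinality, so any set of them has a member of
  greatest cardinality, and enlarging that member leaves the set.
\<close>

lemma wf_enlarge_simplex:
  fixes F :: "'i \<Rightarrow> 'w set"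
  assumes dim: "\<And>i. i \<in> I \<Longrightarrow> \<exists>n::nat. \<forall>S \<in> nerve I F. i \<in> S \<longrightarrow> card S \<le> n"
  shows "wf {(T, S). S \<in> nerve I F \<and> T \<in> nerve I F \<and> S \<subset> T}"
proof (rule wfI_min)
  fix S and Q :: "'i set set" assume "S \<in> Q"
  let ?R = "{(T, S). S \<in> nerve I F \<and> T \<in> nerve I F \<and> S \<subset> T}"
  show "\<exists>M\<in>Q. \<forall>T. (T, M) \<in> ?R \<longrightarrow> T \<notin> Q"
  proof (cases "S \<in> nerve I F")
    case True
    then obtain i where i: "i \<in> S" "i \<in> I" by (auto simp: nerve_def)
    obtain n where n: "\<forall>T \<in> nerve I F. i \<in> T \<longrightarrow> card T \<le> n"
      using dim[OF i(2)] by blast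
    let ?P = "\<lambda>T. T \<in> Q \<and> T \<in> nerve I F \<and> i \<in> T"
    have "\<exists>M. ?P M \<and> (\<forall>T. ?P T \<longrightarrow> card T \<le> card M)"
      by (rule ex_has_greatest_nat[of ?P S card "Suc n"])
        (use True \<open>S \<in> Q\<close> i n in \<open>auto simp: less_Suc_eq_le\<close>)
    then obtain M where M: "?P M" "\<And>T. ?P T \<Longrightarrow> card T \<le> card M" by blast
    have "T \<notin> Q" if "(T, M) \<in> ?R" for T
    proof
      assume "T \<in> Q"
      with that M(1) have "card T \<le> card M" by (intro M(2)) auto
      moreover have "card M < card T"
        using that by (auto simp: nerve_def intro: psubset_card_mono)
      ultimately show False by simp
    qed
    with M(1) show ?thesis by blast
  next
    case False
    with \<open>S \<in> Q\<close> show ?thesis by blast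
  qed
qed

section \<open>Extending maps with prescribed carriers\<close>

lemma paste_on_locally_finite_union:
  assumes fin: "\<And>x. x \<in> topspace W \<Longrightarrow> \<exists>V. openin W V \<and> x \<in> V \<and> finite {i \<in> I. T i \<inter> V \<noteq> {}}"
    and clo: "\<And>i. i \<in> I \<Longrightarrow> closedin W (T i)"
    and cont: "\<And>i. i \<in> I \<Longrightarrow> continuous_map (subtopology W (T i)) Y (f i)"
    and agree: "\<And>i j x. \<lbrakk>i \<in> I; j \<in> I; x \<in> T i; x \<in> T j\<rbrakk> \<Longrightarrow> f i x = f j x"
  obtains h where "closedin W (\<Union>i\<in>I. T i)"
    and "continuous_map (subtopology W (\<Union>i\<in>I. T i)) Y h"
    and "\<And>i x. \<lbrakk>i \<in> I; x \<in> T i\<rbrakk> \<Longrightarrow> h x = f i x"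
proof -
  let ?A = "\<Union>i\<in>I. T i"
  define h where "h x = f (SOME i. i \<in> I \<and> x \<in> T i) x" for x
  have h: "h x = f i x" if "i \<in> I" "x \<in> T i" for i x
    unfolding h_def using someI[of "\<lambda>i. i \<in> I \<and> x \<in> T i" i] that by (intro agree) auto
  have "locally_finite_in W (T ` I)"
    unfolding locally_finite_in_def
  proof (intro conjI ballI)
    show "\<Union>(T ` I) \<subseteq> topspace W" using clo closedin_subset by blast
  next
    fix x assume "x \<in> topspace W"
    then obtain V where V: "openin W V" "x \<in> V" "finite {i \<in> I. T i \<inter> V \<noteq> {}}"
      using fin by blast
    have "finite {U \<in> T ` I. U \<inter> V \<noteq> {}}"
      by (rule finite_surj[OF V(3), where f = T]) auto
    with V show "\<exists>V. openin W V \<and> x \<in> V \<and> finite {U \<in> T ` I. U \<inter> V \<noteq> {}}"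
      by blast
  qed
  then have 1: "closedin W ?A"
    by (rule closedin_locally_finite_Union[rotated]) (use clo in auto)
  have 2: "continuous_map (subtopology W ?A) Y h"
  proof (rule pasting_lemma_locally_finite[where T = T and I = I and f = f])
    fix x assume "x \<in> topspace (subtopology W ?A)"
    then obtain V where V: "openin W V" "x \<in> V" "finite {i \<in> I. T i \<inter> V \<noteq> {}}" "x \<in> ?A"
      using fin by (metis IntE topspace_subtopology)
    have "finite {i \<in> I. T i \<inter> (V \<inter> ?A) \<noteq> {}}"
      by (rule finite_subset[OF _ V(3)]) auto
    then show "\<exists>V. openin (subtopology W ?A) V \<and> x \<in> V \<and> finite {i \<in> I. T i \<inter> V \<noteq> {}}"
      using V by (intro exI[of _ "V \<inter> ?A"]) (auto simp: openin_subtopology)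
  next
    fix i assume i: "i \<in> I"
    then have "T i \<subseteq> ?A" by blast
    then show "closedin (subtopology W ?A) (T i)"
      using clo[OF i] by (simp add: closedin_subset_topspace)
    show "continuous_map (subtopology (subtopology W ?A) (T i)) Y (f i)"
      using cont[OF i] \<open>T i \<subseteq> ?A\<close> by (simp add: subtopology_subtopology inf.absorb2)
  next
    fix x assume "x \<in> topspace (subtopology W ?A)"
    then show "\<exists>j. j \<in> I \<and> x \<in> T j \<and> h x = f j x" using h by auto
  qed (use agree in blast)
  show thesis using 1 2 h by (rule that)
qed

lemma absolute_extensorE:
  assumes "absolute_extensor W Z" "closedin W A" "A \<noteq> {}"
    and "continuous_map (subtopology W A) Z u"
  obtains v where "continuous_map W Z v" "\<And>a. a \<in> A \<Longrightarrow> v a = u a"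
  using assms unfolding absolute_extensor_def by metis

text \<open>
  The hypothesis that a non-empty intersection of carriers meets \<open>B\<close> serves the extensor property,
  which extends only from non-empty sets: it supplies a starting point over every simplex.
\<close>

lemma carrier_respecting_extension:
  fixes F :: "'i \<Rightarrow> 'w set" and C :: "'i \<Rightarrow> 'b set"
  assumes fin: "\<And>x. x \<in> topspace W \<Longrightarrow> \<exists>V. openin W V \<and> x \<in> V \<and> finite {i \<in> I. F i \<inter> V \<noteq> {}}"
    and clo: "\<And>i. i \<in> I \<Longrightarrow> closedin W (F i)"
    and cover: "(\<Union>i\<in>I. F i) = topspace W"
    and dim: "\<And>i. i \<in> I \<Longrightarrow> \<exists>n::nat. \<forall>S \<in> nerve I F. i \<in> S \<longrightarrow> card S \<le> n"
    and AE: "\<And>S. \<lbrakk>S \<subseteq> I; S \<noteq> {}\<rbrakk> \<Longrightarrow> absolute_extensor W (subtopology Y (\<Inter>i\<in>S. C i))"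
    and B: "closedin W B"
    and meets: "\<And>S. S \<in> nerve I F \<Longrightarrow> B \<inter> (\<Inter>i\<in>S. F i) \<noteq> {}"
    and u: "continuous_map (subtopology W B) Y u"
    and uC: "\<And>i x. \<lbrakk>i \<in> I; x \<in> B; x \<in> F i\<rbrakk> \<Longrightarrow> u x \<in> C i"
  obtains v where "continuous_map W Y v" "\<And>x. x \<in> B \<Longrightarrow> v x = u x"
    and "\<And>i x. \<lbrakk>i \<in> I; x \<in> F i\<rbrakk> \<Longrightarrow> v x \<in> C i"
proof -
  let ?N = "nerve I F"
  define N where "N S = (\<Inter>i\<in>S. F i)" for S
  define D where "D S = (\<Inter>i\<in>S. C i)" for S
  define R where "R = {(T, S). S \<in> ?N \<and> T \<in> ?N \<and> S \<subset> T}"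
  \<comment> \<open>Compatibility is demanded only with simplices having one vertex more; compatibility with all
    larger simplices then follows by adding vertices one at a time.\<close>
  define P where "P v S r \<longleftrightarrow> (S \<in> ?N \<longrightarrow>
      continuous_map W (subtopology Y (D S)) r \<and>
      (\<forall>x \<in> B \<inter> N S. r x = u x) \<and>
      (\<forall>j \<in> I - S. \<forall>x \<in> N (insert j S). r x = v (insert j S) x))" for v S r
  have nerve_insert: "insert j S \<in> ?N" if "S \<in> ?N" "j \<in> I" "x \<in> N (insert j S)" for j S x
    using that by (auto simp: nerve_def N_def)
  have clN: "closedin W (N S)" if "S \<in> ?N" for S
    unfolding N_def using that clo by (intro closedin_INT) (auto simp: nerve_def)
  have "\<exists>v. \<forall>S. P v S (v S)"
  proof (rule dependent_wf_choice[of R])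
    show "wf R" unfolding R_def using dim by (rule wf_enlarge_simplex)
  next
    fix v w :: "'i set \<Rightarrow> 'w \<Rightarrow> 'b" and S r
    assume "\<And>T. (T, S) \<in> R \<Longrightarrow> v T = w T"
    then have "v (insert j S) = w (insert j S)"
      if "S \<in> ?N" "j \<in> I - S" "x \<in> N (insert j S)" for j x
      using that nerve_insert[of S j x] by (auto simp: R_def)
    then show "P v S r = P w S r" unfolding P_def by (metis DiffD1)
  next
    fix S and v :: "'i set \<Rightarrow> 'w \<Rightarrow> 'b"
    assume IH: "\<And>T. (T, S) \<in> R \<Longrightarrow> P v T (v T)"
    show "\<exists>r. P v S r"
    proof (cases "S \<in> ?N")
      case True
      then obtain i0 where i0: "i0 \<in> S" "S \<subseteq> I" by (auto simp: nerve_def)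
      have PT: "P v (insert j S) (v (insert j S)) \<and> insert j S \<in> ?N"
        if "j \<in> I" "j \<notin> S" "x \<in> N (insert j S)" for j x
      proof -
        have "insert j S \<in> ?N" using nerve_insert True that by blast
        moreover from this have "(insert j S, S) \<in> R" using True that by (auto simp: R_def)
        ultimately show ?thesis using IH by blast
      qed
      \<comment> \<open>The vertices of \<open>S\<close> all carry the piece \<open>B \<inter> N S\<close>, so that one family indexed by \<open>I\<close>
        contains every piece and inherits local finiteness from \<open>F\<close>.\<close>
      define E where "E j = (if j \<in> S then B \<inter> N S else N (insert j S))" for j
      define e where "e j = (if j \<in> S then u else v (insert j S))" for j
      have EF: "E j \<subseteq> F j" if "j \<in> I" for j by (auto simp: E_def N_def)
      obtain h where h: "closedin W (\<Union>j\<in>I. E j)"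
          "continuous_map (subtopology W (\<Union>j\<in>I. E j)) (subtopology Y (D S)) h"
          and he: "\<And>j x. \<lbrakk>j \<in> I; x \<in> E j\<rbrakk> \<Longrightarrow> h x = e j x"
      proof (rule paste_on_locally_finite_union[of W I E "subtopology Y (D S)" e])
        fix x assume "x \<in> topspace W"
        then obtain V where V: "openin W V" "x \<in> V" "finite {i \<in> I. F i \<inter> V \<noteq> {}}"
          using fin by blast
        have "finite {i \<in> I. E i \<inter> V \<noteq> {}}"
          by (rule finite_subset[OF _ V(3)]) (use EF in blast)
        with V show "\<exists>V. openin W V \<and> x \<in> V \<and> finite {i \<in> I. E i \<inter> V \<noteq> {}}" by blast
      next
        fix j assume j: "j \<in> I"
        show "closedin W (E j)"
        proof (cases "j \<in> S \<or> E j = {}")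
          case True
          then show ?thesis using B clN[OF \<open>S \<in> ?N\<close>] by (auto simp: E_def closedin_Int)
        next
          case False
          then show ?thesis using clN PT[OF j] by (auto simp: E_def)
        qed
        show "continuous_map (subtopology W (E j)) (subtopology Y (D S)) (e j)"
        proof (cases "j \<in> S")
          case True
          have "continuous_map (subtopology W (B \<inter> N S)) Y u"
            using u by (metis continuous_map_from_subtopology subtopology_subtopology)
          moreover have "u x \<in> D S" if "x \<in> B \<inter> N S" for x
            using that uC i0 by (auto simp: D_def N_def)
          ultimately show ?thesis using True
            by (auto simp: E_def e_def continuous_map_in_subtopology)
        next
          case False
          show ?thesis
          proof (cases "E j = {}")
            case True
            then show ?thesis by simp
          next
            case nonempty: False
            then have "continuous_map W (subtopology Y (D (insert j S))) (v (insert j S))"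
              using PT[OF j False] False by (auto simp: E_def P_def)
            then have "continuous_map W (subtopology Y (D S)) (v (insert j S))"
              by (auto simp: continuous_map_in_subtopology D_def)
            then show ?thesis using False
              by (simp add: e_def continuous_map_from_subtopology)
          qed
        qed
      next
        fix i j x assume ij: "i \<in> I" "j \<in> I" and x: "x \<in> E i" "x \<in> E j"
        have mixed: "e k x = u x" if "k \<in> I" "k \<notin> S" "x \<in> E k" "x \<in> B" for k
          using that PT[of k x] by (auto simp: E_def e_def P_def)
        have into_edge: "e k x = v (insert l (insert k S)) x"
          if "k \<in> I" "k \<notin> S" "x \<in> E k" "l \<in> I" "l \<notin> S" "x \<in> E l" "l \<noteq> k" for k l
        proof -
          have "x \<in> N (insert l (insert k S))" using that by (auto simp: E_def N_def)
          then show ?thesis using that PT[of k x] by (auto simp: E_def e_def P_def)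
        qed
        consider "i \<in> S" "j \<in> S" | "i \<in> S" "j \<notin> S" | "i \<notin> S" "j \<in> S"
          | "i = j" | "i \<notin> S" "j \<notin> S" "i \<noteq> j" by blast
        then show "e i x = e j x"
        proof cases
          case 1 then show ?thesis by (simp add: e_def)
        next
          case 2
          then have "e j x = u x" using mixed ij x by (auto simp: E_def)
          with 2 show ?thesis by (simp add: e_def)
        next
          case 3
          then have "e i x = u x" using mixed ij x by (auto simp: E_def)
          with 3 show ?thesis by (simp add: e_def)
        next
          case 5
          then have "e i x = v (insert j (insert i S)) x" "e j x = v (insert i (insert j S)) x"
            using into_edge ij x by auto
          then show ?thesis by (simp add: insert_commute)
        qed simp
      qed blast
      have "B \<inter> N S \<subseteq> E i0" "i0 \<in> I" using i0 by (auto simp: E_def)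
      then have nonempty: "(\<Union>j\<in>I. E j) \<noteq> {}" using meets[OF True] by (auto simp: N_def)
      have "absolute_extensor W (subtopology Y (D S))"
        unfolding D_def using i0 by (intro AE) auto
      then obtain r where r: "continuous_map W (subtopology Y (D S)) r"
          "\<And>x. x \<in> (\<Union>j\<in>I. E j) \<Longrightarrow> r x = h x"
        using h nonempty by (elim absolute_extensorE) blast+
      have rE: "r x = e j x" if "j \<in> I" "x \<in> E j" for j x
        using r(2) he that by (metis UN_I)
      have "P v S r"
        unfolding P_def
      proof (intro impI conjI ballI)
        fix x assume "x \<in> B \<inter> N S"
        then show "r x = u x" using rE[of i0 x] i0 by (auto simp: E_def e_def)
      next
        fix j x assume "j \<in> I - S" "x \<in> N (insert j S)"
        then show "r x = v (insert j S) x" using rE[of j x] by (auto simp: E_def e_def)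
      qed (rule r(1))
      then show ?thesis by (rule exI[where x = r])
    qed (simp add: P_def)
  qed
  then obtain v where v: "\<And>S. P v S (v S)" by blast
  have vertex: "{i} \<in> ?N" if "i \<in> I" "x \<in> F i" for i x
    using that by (auto simp: nerve_def)
  have vcont: "continuous_map W (subtopology Y (C i)) (v {i})"
      and vu: "x \<in> B \<Longrightarrow> v {i} x = u x"
      and vv: "\<lbrakk>j \<in> I; j \<noteq> i; x \<in> F j\<rbrakk> \<Longrightarrow> v {i} x = v {j, i} x"
    if "i \<in> I" "x \<in> F i" for i j x
    using v[of "{i}"] vertex[OF that] that by (auto simp: P_def N_def D_def)
  obtain h where h: "continuous_map (subtopology W (\<Union>i\<in>I. F i)) Y h"
      and hv: "\<And>i x. \<lbrakk>i \<in> I; x \<in> F i\<rbrakk> \<Longrightarrow> h x = v {i} x"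
  proof (rule paste_on_locally_finite_union[of W I F Y "\<lambda>i. v {i}"])
    fix i assume i: "i \<in> I"
    show "continuous_map (subtopology W (F i)) Y (v {i})"
    proof (cases "F i = {}")
      case False
      then show ?thesis
        using vcont[OF i] by (meson continuous_map_from_subtopology continuous_map_into_fulltopology ex_in_conv)
    qed simp
  next
    fix i j x assume "i \<in> I" "j \<in> I" "x \<in> F i" "x \<in> F j"
    then show "v {i} x = v {j} x"
      using vv[of i x j] vv[of j x i] by (metis insert_commute)
  qed (use fin clo in blast)+
  show thesis
  proof (rule that)
    show "continuous_map W Y h" using h cover by simp
    show "h x = u x" if "x \<in> B" for x
    proof -
      have "x \<in> topspace W" using that B closedin_subset by blast
      then obtain i where "i \<in> I" "x \<in> F i" using cover by blast
      then show ?thesis using hv vu that by metis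
    qed
    show "h x \<in> C i" if "i \<in> I" "x \<in> F i" for i x
    proof -
      have "x \<in> topspace W" using that cover by blast
      then have "v {i} x \<in> C i"
        using vcont[OF that] by (auto simp: continuous_map_in_subtopology)
      then show ?thesis using hv that by simp
    qed
  qed
qed

section \<open>Homotopies between close maps\<close>

theorem corollary2p1:
  fixes X :: "'a topology" and Y :: "'b topology" and \<G> :: "'b set set"
    and f g :: "'a \<Rightarrow> 'b"
  assumes "regular_closed_cover (cylinder X) Y \<G>"
    and "continuous_map X Y f" and "continuous_map X Y g"
    and "cover_close X \<G> f g"
  shows "cover_homotopic X Y \<G> f g \<and>
    (\<exists>H. cover_homotopy X Y \<G> f g H \<and>
      (\<forall>x\<in>topspace X. \<forall>G\<in>\<G>. f x \<in> G \<and> g x \<in> G \<longrightarrow> H ` ({x} \<times> {0..1}) \<subseteq> G))"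
proof -
  let ?W = "cylinder X"
  define A where "A G = {x \<in> topspace X. f x \<in> G} \<inter> {x \<in> topspace X. g x \<in> G}" for G
  define F where "F G = A G \<times> {0..1::real}" for G
  define B where "B = topspace X \<times> {0, 1::real}"
  define u where "u = (\<lambda>p. if snd p \<le> (1/2::real) then f (fst p) else g (fst p))"
  have closed: "\<And>G. G \<in> \<G> \<Longrightarrow> closedin Y G"
    and lf: "locally_finite_in Y \<G>"
    and lfd: "locally_finite_dimensional \<G>"
    and AEc: "AE_cover_of ?W Y \<G>"
    using assms(1) by (auto simp: regular_closed_cover_def closed_cover_of_def)
  have fY: "f x \<in> topspace Y" if "x \<in> topspace X" for x
    using assms(2) that by (auto simp: continuous_map_def)
  have uB: "u x \<in> G" if "x \<in> B" "x \<in> F G" for x G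
    using that by (auto simp: u_def F_def A_def B_def)
  \<comment> \<open>Membership in \<open>F G\<close> ignores time, so points can be moved down to the bottom of the cylinder.\<close>
  have B_simplex: "(x, 0) \<in> B \<inter> (\<Inter>G\<in>S. F G)"
    if "(x, t) \<in> (\<Inter>G\<in>S. F G)" "S \<noteq> {}" for x t S
    using that by (auto simp: F_def A_def B_def)
  obtain H where H: "continuous_map ?W Y H" and Hu: "\<And>p. p \<in> B \<Longrightarrow> H p = u p"
    and HF: "\<And>G p. \<lbrakk>G \<in> \<G>; p \<in> F G\<rbrakk> \<Longrightarrow> H p \<in> G"
  proof (rule carrier_respecting_extension[of ?W \<G> F Y "\<lambda>G. G" B u])
    fix p :: "'a \<times> real" assume "p \<in> topspace ?W"
    then obtain x t where p: "p = (x, t)" "x \<in> topspace X" "t \<in> {0..1}" by auto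
    then obtain V where V: "openin Y V" "f x \<in> V" "finite {G \<in> \<G>. G \<inter> V \<noteq> {}}"
      using lf fY unfolding locally_finite_in_def by meson
    let ?V = "{x \<in> topspace X. f x \<in> V} \<times> {0..1::real}"
    have "openin ?W ?V"
      using assms(2) V(1) openin_topspace[of "top_of_set {0..1::real}"]
      by (auto simp: openin_prod_Times_iff continuous_map_def)
    moreover have "finite {G \<in> \<G>. F G \<inter> ?V \<noteq> {}}"
      by (rule finite_subset[OF _ V(3)]) (auto simp: F_def A_def)
    ultimately show "\<exists>V. openin ?W V \<and> p \<in> V \<and> finite {G \<in> \<G>. F G \<inter> V \<noteq> {}}"
      using p V(2) by (intro exI[of _ ?V]) auto
  next
    fix G assume "G \<in> \<G>"
    then have "closedin X (A G)"
      unfolding A_def using closed assms(2,3)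
      by (intro closedin_Int closedin_continuous_map_preimage)
    then show "closedin ?W (F G)"
      using closedin_topspace[of "top_of_set {0..1::real}"]
      by (auto simp: F_def closedin_prod_Times_iff)
    obtain n :: nat where n: "\<And>S. \<lbrakk>S \<subseteq> \<G>; finite S; G \<in> S; \<Inter>S \<noteq> {}\<rbrakk> \<Longrightarrow> card S \<le> n"
      using lfd \<open>G \<in> \<G>\<close> unfolding locally_finite_dimensional_def by meson
    have "card S \<le> n" if S: "S \<in> nerve \<G> F" "G \<in> S" for S
    proof -
      obtain x t where "(x, t) \<in> (\<Inter>G\<in>S. F G)" using S by (auto simp: nerve_def)
      then have "f x \<in> \<Inter>S" by (auto simp: F_def A_def)
      then show ?thesis using S by (intro n) (auto simp: nerve_def)
    qed
    then show "\<exists>n. \<forall>S\<in>nerve \<G> F. G \<in> S \<longrightarrow> card S \<le> n" by blast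
  next
    show "(\<Union>G\<in>\<G>. F G) = topspace ?W"
      using assms(4) by (fastforce simp: F_def A_def cover_close_def)
  next
    fix S assume "S \<subseteq> \<G>" "S \<noteq> {}"
    then show "absolute_extensor ?W (subtopology Y (\<Inter>G\<in>S. G))"
      using AEc by (simp add: AE_cover_of_def)
  next
    have "closedin (top_of_set {0..1}) {0, 1::real}"
      by (simp add: closed_subset)
    then show "closedin ?W B" by (auto simp: B_def closedin_prod_Times_iff)
  next
    fix S assume "S \<in> nerve \<G> F"
    then show "B \<inter> (\<Inter>G\<in>S. F G) \<noteq> {}"
      using B_simplex[of _ _ S] by (fastforce simp: nerve_def)
  next
    \<comment> \<open>The two branches never meet on \<open>B\<close>, whose time coordinate omits \<open>1/2\<close>.\<close>
    show "continuous_map (subtopology ?W B) Y u"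
      unfolding u_def
    proof (rule continuous_map_cases_le)
      have "continuous_map ?W euclideanreal snd"
        using continuous_map_snd continuous_map_into_fulltopology by blast
      then show "continuous_map (subtopology ?W B) euclideanreal snd"
        by (rule continuous_map_from_subtopology)
      have "continuous_map ?W Y (\<lambda>p. f (fst p))" "continuous_map ?W Y (\<lambda>p. g (fst p))"
        using assms(2,3) continuous_map_fst continuous_map_compose[unfolded o_def] by blast+
      then show "continuous_map (subtopology (subtopology ?W B)
            {p \<in> topspace (subtopology ?W B). snd p \<le> 1/2}) Y (\<lambda>p. f (fst p))"
          "continuous_map (subtopology (subtopology ?W B)
            {p \<in> topspace (subtopology ?W B). 1/2 \<le> snd p}) Y (\<lambda>p. g (fst p))"
        by (simp_all add: continuous_map_from_subtopology)
    qed (auto simp: B_def)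
  qed (use uB in auto)
  have track: "H ` ({x} \<times> {0..1}) \<subseteq> G"
    if "x \<in> topspace X" "G \<in> \<G>" "f x \<in> G" "g x \<in> G" for x G
    using that HF by (auto simp: F_def A_def)
  have "cover_homotopy X Y \<G> f g H"
    unfolding cover_homotopy_def
  proof (intro conjI ballI)
    fix x assume x: "x \<in> topspace X"
    then show "H (x, 0) = f x" "H (x, 1) = g x" by (auto simp: Hu B_def u_def)
    show "\<exists>G\<in>\<G>. H ` ({x} \<times> {0..1}) \<subseteq> G"
      using assms(4) x track unfolding cover_close_def by meson
  qed (rule H)
  then show ?thesis using track unfolding cover_homotopic_def by blast
qed

end
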